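(* Let $\Lambda=\{(V_i,\Lambda_i,v_i)\}_{i\in I}$ and $\Gamma=\{(W_j,\Gamma_j,w_j)\}_{j\in J}$. The family $\Lambda\otimes\Gamma=\{(V_i\otimes W_j,\Lambda_i\otimes\Gamma_j,v_iw_j)\}_{i\in I,\,j\in J}$ is a $g$-$p$-fusion frame for $X\otimes Y$ with respect to $\{X_i\otimes Y_j\}_{i\in I,\,j\in J}$ if and only if $\Lambda$ is a $g$-$p$-fusion frame for $X$ with respect to $\{X_i\}_{i\in I}$ and $\Gamma$ is a $g$-$p$-fusion frame for $Y$ with respect to $\{Y_j\}_{j\in J}$.
   Context: $X,Y$ are separable Banach spaces over $\mathbb K$ ($\mathbb R$ or $\mathbb C$), $p\in(1,\infty)$, $I,J\subset\mathbb N$, $\{X_i\}_{i\in I}$ and $\{Y_j\}_{j\in J}$ are sequences of Banach spaces over $\mathbb K$, $\Lambda_i\in\mathcal B(X,X_i)$ and $\Gamma_j\in\mathcal B(Y,Y_j)$ are bounded linear operators, and $v_i,w_j>0$ are weights. $V_i\subset X$ and $W_j\subset Y$ are closed subspaces, with fixed (as part of the data) non-trivial (nonzero) linear projections $P_{V_i}$ of $X$ onto $V_i$ and $P_{W_j}$ of $Y$ onto $W_j$. The family $\Lambda$ is a $g$-$p$-fusion frame for $X$ with respect to $\{X_i\}_{i\in I}$ if there are constants $0<A\le B<\infty$ with $A\|f\|\le\big(\sum_{i\in I}v_i^p\|\Lambda_iP_{V_i}(f)\|^p\big)^{1/p}\le B\|f\|$ for all $f\in X$; analogously for $\Gamma$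 and $Y$. The tensor product $X\otimes Y$ carries a norm satisfying $\|f\otimes g\|=\|f\|_X\|g\|_Y$ for $f\in X$, $g\in Y$; likewise for $X_i\otimes Y_j$. On elementary tensors, $(\Lambda_i\otimes\Gamma_j)(f\otimes g)=\Lambda_if\otimes\Gamma_jg$ and $P_{V_i\otimes W_j}(f\otimes g)=P_{V_i}f\otimes P_{W_j}g$. The family $\Lambda\otimes\Gamma$ is said to be a $g$-$p$-fusion frame for $X\otimes Y$ with respect to $\{X_i\otimes Y_j\}_{i,j}$ if there are constants $A,B>0$ such that for all elementary tensors $f\otimes g$ ($f\in X$, $g\in Y$) $$A\|f\otimes g\|\le\Big(\sum_{i,j}v_i^pw_j^p\|(\Lambda_i\otimes\Gamma_j)P_{V_i\otimes W_j}(f\otimes g)\|^p\Big)^{1/p}\le B\|f\otimes g\|.$$ *)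

theory Defs
  imports
    "HOL-Analysis.Analysis"
    "HOL-Algebra.Module"
    "HOL-Library.Poly_Mapping"
begin

section \<open>Normed spaces with explicit carriers\<close>

text \<open>
  The spaces \<open>X\<^sub>i\<close> vary with the index, so they cannot be types; all spaces are HOL-Algebra modules
  with a norm attached. The fields \<open>mult\<close> and \<open>one\<close>, inherited from rings, play no role.

  The scalar field is a type of class \<^class>\<open>real_normed_field\<close>. The norm of such a field is
  multiplicative and extends the absolute value of the reals, so by the Gelfand--Mazur theorem it
  is \<open>\<real>\<close> or \<open>\<complex>\<close>.
\<close>

record ('k, 'a) normed_module = "('k, 'a) module" +
  vnorm :: "'a \<Rightarrow> real"

definition scalars :: "'k::real_normed_field ring" where
  "scalars = \<lparr>carrier = UNIV, mult = (*), one = 1, zero = 0, add = (+)\<rparr>"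

locale normed_space = module scalars X
  for X :: "('k::real_normed_field, 'a) normed_module" (structure) +
  assumes vnorm_nonneg: "x \<in> carrier X \<Longrightarrow> 0 \<le> vnorm X x"
    and vnorm_eq_0_iff: "x \<in> carrier X \<Longrightarrow> vnorm X x = 0 \<longleftrightarrow> x = \<zero>"
    and vnorm_smult: "x \<in> carrier X \<Longrightarrow> vnorm X (a \<odot> x) = norm a * vnorm X x"
    and vnorm_triangle: "x \<in> carrier X \<Longrightarrow> y \<in> carrier X \<Longrightarrow> vnorm X (x \<oplus> y) \<le> vnorm X x + vnorm X y"

text \<open>The value outside the carrier is irrelevant; \<open>0\<close> makes \<^locale>\<open>Metric_space\<close> applicable.\<close>

definition vdist :: "('k, 'a) normed_module \<Rightarrow> 'a \<Rightarrow> 'a \<Rightarrow> real" where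
  "vdist X x y = (if x \<in> carrier X \<and> y \<in> carrier X then vnorm X (x \<ominus>\<^bsub>X\<^esub> y) else 0)"

lemma (in normed_space) Metric_space_vdist: "Metric_space (carrier X) (vdist X)"
proof
  have sym: "vnorm X (x \<ominus> y) = vnorm X (y \<ominus> x)" if "x \<in> carrier X" "y \<in> carrier X" for x y
  proof -
    have one: "\<one>\<^bsub>scalars\<^esub> = (1::'k)" "carrier scalars = (UNIV::'k set)"
      by (auto simp: scalars_def)
    have m1: "\<ominus>\<^bsub>scalars\<^esub> (1::'k) = - 1"
      by (rule R.minus_equality) (auto simp: scalars_def)
    have "(- 1::'k) \<odot> (y \<ominus> x) = \<ominus> (y \<ominus> x)"
      using smult_l_minus[of "1::'k" "y \<ominus> x"] smult_one[of "y \<ominus> x"] that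
      by (simp add: one m1)
    also have "\<dots> = x \<ominus> y"
      using that by (simp add: minus_eq M.minus_add M.add.m_comm)
    finally show ?thesis
      using vnorm_smult[of "y \<ominus> x" "- 1"] that by simp
  qed
  show "0 \<le> vdist X x y" for x y
    by (simp add: vdist_def vnorm_nonneg)
  show "vdist X x y = vdist X y x" for x y
    by (simp add: vdist_def sym)
  show "(vdist X x y = 0) = (x = y)" if "x \<in> carrier X" "y \<in> carrier X" for x y
  proof -
    have "x \<ominus> y = \<zero> \<longleftrightarrow> x = y"
      using that by (metis M.add.inv_closed M.add.inv_equality M.minus_minus M.r_neg minus_eq)
    then show ?thesis
      using that by (simp add: vdist_def vnorm_eq_0_iff)
  qed
  show "vdist X x z \<le> vdist X x y + vdist X y z"
    if "x \<in> carrier X" "y \<in> carrier X" "z \<in> carrier X" for x y z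
  proof -
    have "x \<ominus> z = (x \<ominus> y) \<oplus> (y \<ominus> z)"
      using that by (simp add: minus_eq M.a_assoc M.r_neg1 M.r_neg2)
    then show ?thesis
      using that vnorm_triangle[of "x \<ominus> y" "y \<ominus> z"] by (simp add: vdist_def)
  qed
qed

definition vtopology :: "('k, 'a) normed_module \<Rightarrow> 'a topology" where
  "vtopology X = Metric_space.mtopology (carrier X) (vdist X)"

definition banach_space :: "('k::real_normed_field, 'a) normed_module \<Rightarrow> bool" where
  "banach_space X \<longleftrightarrow> normed_space X \<and> Metric_space.mcomplete (carrier X) (vdist X)"

definition linear_op ::
  "('k::real_normed_field, 'a) normed_module \<Rightarrow> ('k, 'b) normed_module \<Rightarrow> ('a \<Rightarrow> 'b) \<Rightarrow> bool" where
  "linear_op X Y T \<longleftrightarrow>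
     T \<in> carrier X \<rightarrow> carrier Y \<and>
     (\<forall>x\<in>carrier X. \<forall>y\<in>carrier X. T (x \<oplus>\<^bsub>X\<^esub> y) = T x \<oplus>\<^bsub>Y\<^esub> T y) \<and>
     (\<forall>a. \<forall>x\<in>carrier X. T (a \<odot>\<^bsub>X\<^esub> x) = a \<odot>\<^bsub>Y\<^esub> T x)"

definition bounded_linear_op ::
  "('k::real_normed_field, 'a) normed_module \<Rightarrow> ('k, 'b) normed_module \<Rightarrow> ('a \<Rightarrow> 'b) \<Rightarrow> bool" where
  "bounded_linear_op X Y T \<longleftrightarrow>
     linear_op X Y T \<and> (\<exists>C. \<forall>x\<in>carrier X. vnorm Y (T x) \<le> C * vnorm X x)"

definition closed_subspace :: "('k::real_normed_field, 'a) normed_module \<Rightarrow> 'a set \<Rightarrow> bool" where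
  "closed_subspace X V \<longleftrightarrow> submodule V scalars X \<and> closedin (vtopology X) V"

definition projection_onto ::
  "('k::real_normed_field, 'a) normed_module \<Rightarrow> 'a set \<Rightarrow> ('a \<Rightarrow> 'a) \<Rightarrow> bool" where
  "projection_onto X V P \<longleftrightarrow>
     linear_op X X P \<and> P ` carrier X = V \<and> (\<forall>x\<in>carrier X. P (P x) = P x)"


section \<open>\<open>g\<close>-\<open>p\<close>-fusion frames\<close>

text \<open>
  The standing assumptions on a family \<open>(V\<^sub>i, \<Lambda>\<^sub>i, v\<^sub>i)\<close> with nonzero projections \<open>P\<^sub>i\<close> onto \<open>V\<^sub>i\<close>.
  They imply \<open>X \<noteq> 0\<close> as soon as \<open>I\<close> is nonempty. Projections are not required to be bounded.
\<close>

definition fusion_family ::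
  "('k::real_normed_field, 'a) normed_module \<Rightarrow> nat set \<Rightarrow> (nat \<Rightarrow> ('k, 'c) normed_module) \<Rightarrow>
   (nat \<Rightarrow> 'a set) \<Rightarrow> (nat \<Rightarrow> 'a \<Rightarrow> 'a) \<Rightarrow> (nat \<Rightarrow> 'a \<Rightarrow> 'c) \<Rightarrow> (nat \<Rightarrow> real) \<Rightarrow> bool" where
  "fusion_family X I Xs V P \<Lambda> v \<longleftrightarrow>
     (\<forall>i\<in>I. banach_space (Xs i) \<and> closed_subspace X (V i) \<and>
        projection_onto X (V i) (P i) \<and> (\<exists>x\<in>carrier X. P i x \<noteq> \<zero>\<^bsub>X\<^esub>) \<and>
        bounded_linear_op X (Xs i) (\<Lambda> i) \<and> 0 < v i)"

text \<open>
  Since \<^term>\<open>infsum\<close> is \<open>0\<close> for divergent sums, convergence (finiteness of the sum in the upper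
  bound) is stated separately.
\<close>

definition g_p_fusion_frame ::
  "real \<Rightarrow> ('k::real_normed_field, 'a) normed_module \<Rightarrow> nat set \<Rightarrow> (nat \<Rightarrow> ('k, 'c) normed_module) \<Rightarrow>
   (nat \<Rightarrow> 'a \<Rightarrow> 'a) \<Rightarrow> (nat \<Rightarrow> 'a \<Rightarrow> 'c) \<Rightarrow> (nat \<Rightarrow> real) \<Rightarrow> bool" where
  "g_p_fusion_frame p X I Xs P \<Lambda> v \<longleftrightarrow>
     (\<exists>A B. 0 < A \<and> A \<le> B \<and>
       (\<forall>f\<in>carrier X.
          (\<lambda>i. v i powr p * vnorm (Xs i) (\<Lambda> i (P i f)) powr p) summable_on I \<and>
          A * vnorm X f \<le>
            (\<Sum>\<^sub>\<infinity>i\<in>I. v i powr p * vnorm (Xs i) (\<Lambda> i (P i f)) powr p) powr (1 / p) \<and>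
          (\<Sum>\<^sub>\<infinity>i\<in>I. v i powr p * vnorm (Xs i) (\<Lambda> i (P i f)) powr p) powr (1 / p)
            \<le> B * vnorm X f))"


section \<open>Tensor products\<close>

text \<open>
  The algebraic tensor product: the free vector space on \<open>carrier X \<times> carrier Y\<close>, realised by
  finitely supported functions, modulo the span of the bilinearity relations.
\<close>

definition fscale :: "'k::real_normed_field \<Rightarrow> ('c \<Rightarrow>\<^sub>0 'k) \<Rightarrow> ('c \<Rightarrow>\<^sub>0 'k)" where
  "fscale a u = Poly_Mapping.map ((*) a) u"

definition tensor_free ::
  "('k::real_normed_field, 'a) normed_module \<Rightarrow> ('k, 'b) normed_module \<Rightarrow> ('a \<times> 'b \<Rightarrow>\<^sub>0 'k) set" where
  "tensor_free X Y = {u. Poly_Mapping.keys u \<subseteq> carrier X \<times> carrier Y}"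

abbreviation gen :: "'a \<Rightarrow> 'b \<Rightarrow> ('a \<times> 'b \<Rightarrow>\<^sub>0 'k::real_normed_field)" where
  "gen x y \<equiv> Poly_Mapping.single (x, y) 1"

definition tensor_relators ::
  "('k::real_normed_field, 'a) normed_module \<Rightarrow> ('k, 'b) normed_module \<Rightarrow> ('a \<times> 'b \<Rightarrow>\<^sub>0 'k) set" where
  "tensor_relators X Y =
     {gen (x \<oplus>\<^bsub>X\<^esub> x') y - gen x y - gen x' y | x x' y.
        x \<in> carrier X \<and> x' \<in> carrier X \<and> y \<in> carrier Y} \<union>
     {gen x (y \<oplus>\<^bsub>Y\<^esub> y') - gen x y - gen x y' | x y y'.
        x \<in> carrier X \<and> y \<in> carrier Y \<and> y' \<in> carrier Y} \<union>
     {gen (a \<odot>\<^bsub>X\<^esub> x) y - fscale a (gen x y) | a x y. x \<in> carrier X \<and> y \<in> carrier Y} \<union>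
     {gen x (a \<odot>\<^bsub>Y\<^esub> y) - fscale a (gen x y) | a x y. x \<in> carrier X \<and> y \<in> carrier Y}"

definition tensor_rel ::
  "('k::real_normed_field, 'a) normed_module \<Rightarrow> ('k, 'b) normed_module \<Rightarrow> ('a \<times> 'b \<Rightarrow>\<^sub>0 'k) rel" where
  "tensor_rel X Y =
     {(u, u'). u \<in> tensor_free X Y \<and> u' \<in> tensor_free X Y \<and>
               u - u' \<in> Modules.module.span fscale (tensor_relators X Y)}"

text \<open>\<open>X \<otimes> Y\<close> equipped with a given norm \<open>N\<close>; its elements are equivalence classes.\<close>

definition tensor_space ::
  "('k::real_normed_field, 'a) normed_module \<Rightarrow> ('k, 'b) normed_module \<Rightarrow>
   (('a \<times> 'b \<Rightarrow>\<^sub>0 'k) set \<Rightarrow> real) \<Rightarrow> ('k, ('a \<times> 'b \<Rightarrow>\<^sub>0 'k) set) normed_module" where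
  "tensor_space X Y N =
     \<lparr>carrier = tensor_free X Y // tensor_rel X Y,
      mult = undefined, one = undefined,
      zero = tensor_rel X Y `` {0},
      add = (\<lambda>s t. \<Union>u\<in>s. \<Union>u'\<in>t. tensor_rel X Y `` {u + u'}),
      smult = (\<lambda>a s. \<Union>u\<in>s. tensor_rel X Y `` {fscale a u}),
      vnorm = N\<rparr>"

definition tens ::
  "('k::real_normed_field, 'a) normed_module \<Rightarrow> ('k, 'b) normed_module \<Rightarrow>
   'a \<Rightarrow> 'b \<Rightarrow> ('a \<times> 'b \<Rightarrow>\<^sub>0 'k) set" where
  "tens X Y x y = tensor_rel X Y `` {gen x y}"

definition cross_norm ::
  "('k::real_normed_field, 'a) normed_module \<Rightarrow> ('k, 'b) normed_module \<Rightarrow>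
   (('a \<times> 'b \<Rightarrow>\<^sub>0 'k) set \<Rightarrow> real) \<Rightarrow> bool" where
  "cross_norm X Y N \<longleftrightarrow>
     normed_space (tensor_space X Y N) \<and>
     (\<forall>x\<in>carrier X. \<forall>y\<in>carrier Y. N (tens X Y x y) = vnorm X x * vnorm Y y)"

definition free_map ::
  "('a \<Rightarrow> 'c) \<Rightarrow> ('b \<Rightarrow> 'd) \<Rightarrow> ('a \<times> 'b \<Rightarrow>\<^sub>0 'k::real_normed_field) \<Rightarrow> ('c \<times> 'd \<Rightarrow>\<^sub>0 'k)" where
  "free_map S T u =
     (\<Sum>z\<in>Poly_Mapping.keys u. Poly_Mapping.single (map_prod S T z) (Poly_Mapping.lookup u z))"

text \<open>
  The linear map \<open>S \<otimes> T : X \<otimes> Y \<rightarrow> X' \<otimes> Y'\<close>, well defined for linear \<open>S : X \<rightarrow> X'\<close> and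
  \<open>T : Y \<rightarrow> Y'\<close>; see \<open>tensor_map_tens\<close> and \<open>linear_op_tensor_map\<close> below.
\<close>

definition tensor_map ::
  "('k::real_normed_field, 'a) normed_module \<Rightarrow> ('k, 'b) normed_module \<Rightarrow>
   ('k, 'c) normed_module \<Rightarrow> ('k, 'd) normed_module \<Rightarrow> ('a \<Rightarrow> 'c) \<Rightarrow> ('b \<Rightarrow> 'd) \<Rightarrow>
   ('a \<times> 'b \<Rightarrow>\<^sub>0 'k) set \<Rightarrow> ('c \<times> 'd \<Rightarrow>\<^sub>0 'k) set" where
  "tensor_map X Y X' Y' S T t = (\<Union>u\<in>t. tensor_rel X' Y' `` {free_map S T u})"

lemma lookup_fscale [simp]: "Poly_Mapping.lookup (fscale a u) k = a * Poly_Mapping.lookup u k"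
  by (simp add: fscale_def Poly_Mapping.map.rep_eq when_def)

interpretation fscale: Modules.module fscale
  by standard (auto intro!: poly_mapping_eqI simp: lookup_add algebra_simps)

lemma tensor_free_closed:
  "0 \<in> tensor_free X Y"
  "u \<in> tensor_free X Y \<Longrightarrow> u' \<in> tensor_free X Y \<Longrightarrow> u + u' \<in> tensor_free X Y"
  "u \<in> tensor_free X Y \<Longrightarrow> u' \<in> tensor_free X Y \<Longrightarrow> u - u' \<in> tensor_free X Y"
  "u \<in> tensor_free X Y \<Longrightarrow> fscale a u \<in> tensor_free X Y"
  "x \<in> carrier X \<Longrightarrow> y \<in> carrier Y \<Longrightarrow> gen x y \<in> tensor_free X Y"
proof -
  have mem: "u \<in> tensor_free X Y \<longleftrightarrow>
      (\<forall>z. z \<notin> carrier X \<times> carrier Y \<longrightarrow> Poly_Mapping.lookup u z = 0)" for u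
    by (auto simp: tensor_free_def in_keys_iff subset_iff simp del: mem_Sigma_iff)
  show "0 \<in> tensor_free X Y"
    "u \<in> tensor_free X Y \<Longrightarrow> u' \<in> tensor_free X Y \<Longrightarrow> u + u' \<in> tensor_free X Y"
    "u \<in> tensor_free X Y \<Longrightarrow> u' \<in> tensor_free X Y \<Longrightarrow> u - u' \<in> tensor_free X Y"
    "u \<in> tensor_free X Y \<Longrightarrow> fscale a u \<in> tensor_free X Y"
    by (simp_all add: mem lookup_add lookup_minus del: mem_Sigma_iff)
  show "x \<in> carrier X \<Longrightarrow> y \<in> carrier Y \<Longrightarrow> gen x y \<in> tensor_free X Y"
    by (simp add: tensor_free_def)
qed

lemma free_map_superset:
  assumes "finite A" "Poly_Mapping.keys u \<subseteq> A"
  shows "free_map S T u =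
    (\<Sum>z\<in>A. Poly_Mapping.single (map_prod S T z) (Poly_Mapping.lookup u z))"
  unfolding free_map_def using assms
  by (intro sum.mono_neutral_left) (auto simp: in_keys_iff)

lemma free_map_add: "free_map S T (u + u') = free_map S T u + free_map S T u'"
proof -
  let ?A = "Poly_Mapping.keys u \<union> Poly_Mapping.keys u'"
  have "Poly_Mapping.keys (u + u') \<subseteq> ?A"
    by (rule keys_add)
  then show ?thesis
    by (simp add: free_map_superset[of ?A] lookup_add single_add sum.distrib)
qed

lemma free_map_fscale: "free_map S T (fscale a u) = fscale a (free_map S T u)"
proof -
  have *: "fscale a (Poly_Mapping.single k b) = Poly_Mapping.single k (a * b)" for k :: 'e and b
    by (rule poly_mapping_eqI) (simp add: lookup_single when_def)
  have "Poly_Mapping.keys (fscale a u) \<subseteq> Poly_Mapping.keys u"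
    by (auto simp: in_keys_iff)
  then show ?thesis
    by (simp add: free_map_superset[of "Poly_Mapping.keys u"] fscale.scale_sum_right)
      (simp add: fscale_def)
qed

lemma free_map_diff: "free_map S T (u - u') = free_map S T u - free_map S T u'"
  using free_map_add[of S T "u - u'" u'] by simp

lemma free_map_gen: "free_map S T (gen x y) = gen (S x) (T y)"
  by (simp add: free_map_def)

lemma free_map_tensor_free:
  assumes "linear_op X X' S" "linear_op Y Y' T" "u \<in> tensor_free X Y"
  shows "free_map S T u \<in> tensor_free X' Y'"
proof -
  have maps: "map_prod S T z \<in> carrier X' \<times> carrier Y'" if "z \<in> Poly_Mapping.keys u" for z
    using that assms by (cases z) (auto simp: tensor_free_def linear_op_def)
  have "Poly_Mapping.keys (free_map S T u)
      \<subseteq> (\<Union>z\<in>Poly_Mapping.keys u.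
            Poly_Mapping.keys (Poly_Mapping.single (map_prod S T z) (Poly_Mapping.lookup u z)))"
    unfolding free_map_def by (rule keys_sum)
  also have "\<dots> \<subseteq> carrier X' \<times> carrier Y'"
    using maps by (intro UN_least) (simp del: mem_Sigma_iff)
  finally show ?thesis
    by (simp add: tensor_free_def)
qed

lemma tensor_relatorsI:
  "x \<in> carrier X \<Longrightarrow> x' \<in> carrier X \<Longrightarrow> y \<in> carrier Y \<Longrightarrow>
    gen (x \<oplus>\<^bsub>X\<^esub> x') y - gen x y - gen x' y \<in> tensor_relators X Y"
  "x \<in> carrier X \<Longrightarrow> y \<in> carrier Y \<Longrightarrow> y' \<in> carrier Y \<Longrightarrow>
    gen x (y \<oplus>\<^bsub>Y\<^esub> y') - gen x y - gen x y' \<in> tensor_relators X Y"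
  "x \<in> carrier X \<Longrightarrow> y \<in> carrier Y \<Longrightarrow>
    gen (a \<odot>\<^bsub>X\<^esub> x) y - fscale a (gen x y) \<in> tensor_relators X Y"
  "x \<in> carrier X \<Longrightarrow> y \<in> carrier Y \<Longrightarrow>
    gen x (a \<odot>\<^bsub>Y\<^esub> y) - fscale a (gen x y) \<in> tensor_relators X Y"
  unfolding tensor_relators_def by blast+

lemma free_map_tensor_relators:
  assumes "linear_op X X' S" "linear_op Y Y' T" "u \<in> tensor_relators X Y"
  shows "free_map S T u \<in> tensor_relators X' Y'"
proof -
  have S: "S x \<in> carrier X'" "S (x \<oplus>\<^bsub>X\<^esub> x') = S x \<oplus>\<^bsub>X'\<^esub> S x'" "S (a \<odot>\<^bsub>X\<^esub> x) = a \<odot>\<^bsub>X'\<^esub> S x"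
    if "x \<in> carrier X" "x' \<in> carrier X" for x x' a
    using assms(1) that by (auto simp: linear_op_def)
  have T: "T x \<in> carrier Y'" "T (x \<oplus>\<^bsub>Y\<^esub> x') = T x \<oplus>\<^bsub>Y'\<^esub> T x'" "T (a \<odot>\<^bsub>Y\<^esub> x) = a \<odot>\<^bsub>Y'\<^esub> T x"
    if "x \<in> carrier Y" "x' \<in> carrier Y" for x x' a
    using assms(2) that by (auto simp: linear_op_def)
  from assms(3) consider
      (1) x x' y where "u = gen (x \<oplus>\<^bsub>X\<^esub> x') y - gen x y - gen x' y"
        "x \<in> carrier X" "x' \<in> carrier X" "y \<in> carrier Y"
    | (2) x y y' where "u = gen x (y \<oplus>\<^bsub>Y\<^esub> y') - gen x y - gen x y'"
        "x \<in> carrier X" "y \<in> carrier Y" "y' \<in> carrier Y"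
    | (3) a x y where "u = gen (a \<odot>\<^bsub>X\<^esub> x) y - fscale a (gen x y)" "x \<in> carrier X" "y \<in> carrier Y"
    | (4) a x y where "u = gen x (a \<odot>\<^bsub>Y\<^esub> y) - fscale a (gen x y)" "x \<in> carrier X" "y \<in> carrier Y"
    unfolding tensor_relators_def by blast
  then show ?thesis
    by cases (simp_all add: free_map_diff free_map_gen free_map_fscale S T tensor_relatorsI)
qed

lemma free_map_span:
  assumes "linear_op X X' S" "linear_op Y Y' T" "u \<in> fscale.span (tensor_relators X Y)"
  shows "free_map S T u \<in> fscale.span (tensor_relators X' Y')"
  using assms(3)
proof (induction rule: fscale.span_induct_alt)
  case base
  then show ?case
    by (simp add: free_map_def fscale.span_zero)
next
  case (step c x y)
  then show ?case
    using free_map_tensor_relators[OF assms(1,2)]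
    by (simp add: free_map_add free_map_fscale fscale.span_add fscale.span_scale fscale.span_base)
qed

lemma equiv_tensor_rel: "equiv (tensor_free X Y) (tensor_rel X Y)"
proof (rule equivI)
  show "tensor_rel X Y \<subseteq> tensor_free X Y \<times> tensor_free X Y"
    by (auto simp: tensor_rel_def)
  show "refl_on (tensor_free X Y) (tensor_rel X Y)"
    by (auto simp: tensor_rel_def refl_on_def fscale.span_zero)
  show "sym (tensor_rel X Y)"
    unfolding sym_def tensor_rel_def using fscale.span_neg by fastforce
  show "trans (tensor_rel X Y)"
    unfolding trans_def tensor_rel_def using fscale.span_add by fastforce
qed

lemma tensor_class_eqI:
  assumes "u \<in> tensor_free X Y" "u' \<in> tensor_free X Y"
    and "u - u' \<in> fscale.span (tensor_relators X Y)"
  shows "tensor_rel X Y `` {u} = tensor_rel X Y `` {u'}"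
  using assms by (intro equiv_class_eq[OF equiv_tensor_rel]) (simp add: tensor_rel_def)

lemma tensor_space_class [simp]:
  assumes "u \<in> tensor_free X Y"
  shows "tensor_rel X Y `` {u} \<in> carrier (tensor_space X Y N)"
    and "u' \<in> tensor_free X Y \<Longrightarrow>
      tensor_rel X Y `` {u} \<oplus>\<^bsub>tensor_space X Y N\<^esub> tensor_rel X Y `` {u'} = tensor_rel X Y `` {u + u'}"
    and "a \<odot>\<^bsub>tensor_space X Y N\<^esub> tensor_rel X Y `` {u} = tensor_rel X Y `` {fscale a u}"
proof -
  show "tensor_rel X Y `` {u} \<in> carrier (tensor_space X Y N)"
    using assms by (simp add: tensor_space_def quotientI)
  have "congruent (tensor_rel X Y) (\<lambda>u. tensor_rel X Y `` {fscale a u})"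
  proof (rule congruentI)
    fix y z assume "(y, z) \<in> tensor_rel X Y"
    then show "tensor_rel X Y `` {fscale a y} = tensor_rel X Y `` {fscale a z}"
      by (intro tensor_class_eqI)
        (auto simp: tensor_rel_def tensor_free_closed fscale.span_scale
          simp flip: fscale.scale_right_diff_distrib)
  qed
  from UN_equiv_class[OF equiv_tensor_rel this assms]
  show "a \<odot>\<^bsub>tensor_space X Y N\<^esub> tensor_rel X Y `` {u} = tensor_rel X Y `` {fscale a u}"
    by (simp add: tensor_space_def)
  assume u': "u' \<in> tensor_free X Y"
  have "congruent2 (tensor_rel X Y) (tensor_rel X Y) (\<lambda>u u'. tensor_rel X Y `` {u + u'})"
  proof (rule congruent2I')
    fix y1 z1 y2 z2 assume "(y1, z1) \<in> tensor_rel X Y" "(y2, z2) \<in> tensor_rel X Y"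
    then show "tensor_rel X Y `` {y1 + y2} = tensor_rel X Y `` {z1 + z2}"
      by (intro tensor_class_eqI)
        (auto simp: tensor_rel_def tensor_free_closed add_diff_add fscale.span_add)
  qed
  from UN_equiv_class2[OF equiv_tensor_rel equiv_tensor_rel this assms u']
  show "tensor_rel X Y `` {u} \<oplus>\<^bsub>tensor_space X Y N\<^esub> tensor_rel X Y `` {u'} = tensor_rel X Y `` {u + u'}"
    by (simp add: tensor_space_def)
qed

lemma tensor_map_class:
  assumes "linear_op X X' S" "linear_op Y Y' T" "u \<in> tensor_free X Y"
  shows "tensor_map X Y X' Y' S T (tensor_rel X Y `` {u}) = tensor_rel X' Y' `` {free_map S T u}"
proof -
  have "congruent (tensor_rel X Y) (\<lambda>u. tensor_rel X' Y' `` {free_map S T u})"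
  proof (rule congruentI)
    fix y z assume "(y, z) \<in> tensor_rel X Y"
    then show "tensor_rel X' Y' `` {free_map S T y} = tensor_rel X' Y' `` {free_map S T z}"
      by (intro tensor_class_eqI)
        (auto simp: tensor_rel_def free_map_tensor_free[OF assms(1,2)] free_map_span[OF assms(1,2)]
          simp flip: free_map_diff)
  qed
  from UN_equiv_class[OF equiv_tensor_rel this assms(3)] show ?thesis
    by (simp add: tensor_map_def)
qed

lemma tensor_map_tens:
  assumes "linear_op X X' S" "linear_op Y Y' T" "x \<in> carrier X" "y \<in> carrier Y"
  shows "tensor_map X Y X' Y' S T (tens X Y x y) = tens X' Y' (S x) (T y)"
  using tensor_map_class[OF assms(1,2)] assms(3,4)
  by (simp add: tens_def tensor_free_closed free_map_gen)

lemma tensor_space_cases: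
  assumes "t \<in> carrier (tensor_space X Y N)"
  obtains u where "u \<in> tensor_free X Y" "t = tensor_rel X Y `` {u}"
  using assms by (auto simp: tensor_space_def elim: quotientE)

lemma linear_op_tensor_map:
  assumes "linear_op X X' S" "linear_op Y Y' T"
  shows "linear_op (tensor_space X Y N) (tensor_space X' Y' N') (tensor_map X Y X' Y' S T)"
  unfolding linear_op_def
  by (auto elim!: tensor_space_cases simp: tensor_map_class[OF assms] free_map_tensor_free[OF assms]
      tensor_free_closed free_map_add free_map_fscale)

lemma module_tensor_space: "module scalars (tensor_space X Y N)"
proof (rule Module.moduleI)
  let ?T = "tensor_space X Y N"
  have zero: "\<zero>\<^bsub>?T\<^esub> = tensor_rel X Y `` {0}"
    by (simp add: tensor_space_def)
  show "cring (scalars :: 'a ring)"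
  proof (rule cringI)
    show "abelian_group (scalars :: 'a ring)"
    proof (rule abelian_groupI)
      show "\<exists>y\<in>carrier scalars. y \<oplus>\<^bsub>scalars\<^esub> x = \<zero>\<^bsub>scalars\<^esub>" for x :: 'a
        by (rule bexI[of _ "- x"]) (simp_all add: scalars_def)
    qed (simp_all add: scalars_def)
    show "comm_monoid (scalars :: 'a ring)"
      by (rule comm_monoidI) (simp_all add: scalars_def)
  qed (simp add: scalars_def distrib_right)
  show "abelian_group ?T"
  proof (rule abelian_groupI)
    fix t assume "t \<in> carrier ?T"
    then obtain u where u: "u \<in> tensor_free X Y" "t = tensor_rel X Y `` {u}"
      by (rule tensor_space_cases)
    have "- u \<in> tensor_free X Y"
      using u tensor_free_closed(3)[OF tensor_free_closed(1), of u X Y] by simp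
    then show "\<exists>s\<in>carrier ?T. s \<oplus>\<^bsub>?T\<^esub> t = \<zero>\<^bsub>?T\<^esub>"
      using u by (intro bexI[of _ "tensor_rel X Y `` {- u}"]) (simp_all add: zero)
  qed (elim tensor_space_cases | simp add: zero tensor_free_closed ac_simps)+
qed (elim tensor_space_cases
   | simp add: scalars_def tensor_free_closed fscale.scale_left_distrib fscale.scale_right_distrib)+

text \<open>
  The frame condition for \<open>\<Lambda> \<otimes> \<Gamma>\<close> is required on elementary tensors only. The operator attached to
  \<open>(i, j)\<close> is \<open>\<Lambda>\<^sub>i \<otimes> \<Gamma>\<^sub>j\<close>, the projection onto \<open>V\<^sub>i \<otimes> W\<^sub>j\<close> is \<open>P\<^sub>i \<otimes> Q\<^sub>j\<close>; \<open>N\<close> and \<open>Ns i j\<close> are the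
  norms of \<open>X \<otimes> Y\<close> and \<open>X\<^sub>i \<otimes> Y\<^sub>j\<close>.
\<close>

definition tensor_g_p_fusion_frame ::
  "real \<Rightarrow> ('k::real_normed_field, 'a) normed_module \<Rightarrow> ('k, 'b) normed_module \<Rightarrow>
   (('a \<times> 'b \<Rightarrow>\<^sub>0 'k) set \<Rightarrow> real) \<Rightarrow> nat set \<Rightarrow> nat set \<Rightarrow>
   (nat \<Rightarrow> ('k, 'c) normed_module) \<Rightarrow> (nat \<Rightarrow> ('k, 'd) normed_module) \<Rightarrow>
   (nat \<Rightarrow> nat \<Rightarrow> ('c \<times> 'd \<Rightarrow>\<^sub>0 'k) set \<Rightarrow> real) \<Rightarrow>
   (nat \<Rightarrow> 'a \<Rightarrow> 'a) \<Rightarrow> (nat \<Rightarrow> 'b \<Rightarrow> 'b) \<Rightarrow> (nat \<Rightarrow> 'a \<Rightarrow> 'c) \<Rightarrow> (nat \<Rightarrow> 'b \<Rightarrow> 'd) \<Rightarrow>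
   (nat \<Rightarrow> real) \<Rightarrow> (nat \<Rightarrow> real) \<Rightarrow> bool" where
  "tensor_g_p_fusion_frame p X Y N I J Xs Ys Ns P Q \<Lambda> \<Gamma> v w \<longleftrightarrow>
     (\<exists>A B. 0 < A \<and> 0 < B \<and>
       (\<forall>f\<in>carrier X. \<forall>g\<in>carrier Y.
          let a = (\<lambda>(i, j). v i powr p * w j powr p *
                     Ns i j (tensor_map X Y (Xs i) (Ys j) (\<Lambda> i) (\<Gamma> j)
                              (tensor_map X Y X Y (P i) (Q j) (tens X Y f g))) powr p)
          in a summable_on (I \<times> J) \<and>
             A * N (tens X Y f g) \<le> (\<Sum>\<^sub>\<infinity>ij\<in>I \<times> J. a ij) powr (1 / p) \<and>
             (\<Sum>\<^sub>\<infinity>ij\<in>I \<times> J. a ij) powr (1 / p) \<le> B * N (tens X Y f g)))"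

end

theory Submission
  imports Defs
begin

text \<open>
  On an elementary tensor the cross norms turn the term of \<open>\<Lambda> \<otimes> \<Gamma>\<close> with index \<open>(i, j)\<close> into the
  product of the term of \<open>\<Lambda>\<close> with index \<open>i\<close> and the term of \<open>\<Gamma>\<close> with index \<open>j\<close>
  (\<open>tensor_map_tensor_map_tens\<close>). Hence the double sum is the product of the two single sums, and
  \<open>\<parallel>f \<otimes> g\<parallel> = \<parallel>f\<parallel> \<parallel>g\<parallel>\<close>. The rest is about families of nonnegative reals: frame bounds of two
  families multiply to frame bounds of the product family (\<open>frame_bounds_product\<close>); conversely,
  fixing a vector \<open>g\<close> of nonzero norm and dividing the inequalities for \<open>f \<otimes> g\<close> by the then
  constant factor that depends on \<open>g\<close> leaves frame bounds for the first family
  (\<open>frame_bounds_factor\<close>), and exchanging the factors treats the second one.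

  The converse needs care in one place. It is not clear beforehand that the single sums converge,
  and the constant factor must be nonzero. Both follow from the lower bound at one tensor
  \<open>f\<^sub>0 \<otimes> g\<^sub>0\<close> of nonzero norm: it provides a nonzero term, whose row and column in the double sum
  are nonzero multiples of the single families.
\<close>

section \<open>Sums of products\<close>

lemma has_sum_times_nonneg:
  fixes a :: "'i \<Rightarrow> real" and b :: "'j \<Rightarrow> real"
  assumes "(a has_sum s) I" "(b has_sum t) J"
    and "\<And>i. i \<in> I \<Longrightarrow> 0 \<le> a i" "\<And>j. j \<in> J \<Longrightarrow> 0 \<le> b j"
  shows "((\<lambda>(i, j). a i * b j) has_sum s * t) (I \<times> J)"
proof (rule has_sum_SigmaI)
  show row: "((\<lambda>j. case (i, j) of (i, j) \<Rightarrow> a i * b j) has_sum a i * t) J" for i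
    using has_sum_cmult_right[OF assms(2)] by simp
  show col: "((\<lambda>i. a i * t) has_sum s * t) I"
    using has_sum_cmult_left[OF assms(1)] .
  show "(\<lambda>(i, j). a i * b j) summable_on I \<times> J"
    using row has_sum_imp_summable[OF col] by (rule summable_on_SigmaI) (simp add: assms(3,4))
qed

lemma summable_on_left_factor:
  fixes a :: "'i \<Rightarrow> real"
  assumes "(\<lambda>(i, j). a i * b j) summable_on I \<times> J" "j \<in> J" "b j \<noteq> 0"
  shows "a summable_on I"
proof -
  have "(\<lambda>(j, i). a i * b j) summable_on J \<times> I"
    using assms(1) by (simp add: summable_on_swap[of _ I])
  from summable_on_SigmaD1[OF this assms(2)] have "(\<lambda>i. a i * b j) summable_on I"
    by simp
  then show ?thesis
    using assms(3) by (simp add: summable_on_cmult_left')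
qed

lemma summable_on_right_factor:
  fixes a :: "'i \<Rightarrow> real"
  assumes "(\<lambda>(i, j). a i * b j) summable_on I \<times> J" "i \<in> I" "a i \<noteq> 0"
  shows "b summable_on J"
  using summable_on_SigmaD1[OF assms(1,2)] assms(3) by (simp add: summable_on_cmult_right')

section \<open>Frame bounds of families of functions\<close>

text \<open>
  The frame inequalities with the norm and the terms of the sum replaced by arbitrary
  functions, so that one notion covers \<open>\<Lambda>\<close>, \<open>\<Gamma>\<close> and \<open>\<Lambda> \<otimes> \<Gamma>\<close>; for the last, the vectors are the
  pairs \<open>(f, g)\<close>.
\<close>

definition frame_bounds ::
  "real \<Rightarrow> 'f set \<Rightarrow> ('f \<Rightarrow> real) \<Rightarrow> 'i set \<Rightarrow> ('f \<Rightarrow> 'i \<Rightarrow> real) \<Rightarrow> bool" where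
  "frame_bounds p F n I a \<longleftrightarrow>
     (\<exists>A B. 0 < A \<and> 0 < B \<and>
       (\<forall>f\<in>F. a f summable_on I \<and> A * n f \<le> (\<Sum>\<^sub>\<infinity>i\<in>I. a f i) powr (1 / p) \<and>
          (\<Sum>\<^sub>\<infinity>i\<in>I. a f i) powr (1 / p) \<le> B * n f))"

lemma frame_boundsE:
  assumes "frame_bounds p F n I a"
  obtains A B where "0 < A" "0 < B"
    and "\<And>f. f \<in> F \<Longrightarrow> a f summable_on I"
    and "\<And>f. f \<in> F \<Longrightarrow> A * n f \<le> (\<Sum>\<^sub>\<infinity>i\<in>I. a f i) powr (1 / p)"
    and "\<And>f. f \<in> F \<Longrightarrow> (\<Sum>\<^sub>\<infinity>i\<in>I. a f i) powr (1 / p) \<le> B * n f"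
  using assms unfolding frame_bounds_def by blast

lemma frame_bounds_product:
  assumes F: "frame_bounds p F n I a" and G: "frame_bounds p G m J b"
    and n: "\<And>f. f \<in> F \<Longrightarrow> 0 \<le> n f" and m: "\<And>g. g \<in> G \<Longrightarrow> 0 \<le> m g"
    and a: "\<And>f i. f \<in> F \<Longrightarrow> i \<in> I \<Longrightarrow> 0 \<le> a f i" and b: "\<And>g j. g \<in> G \<Longrightarrow> j \<in> J \<Longrightarrow> 0 \<le> b g j"
  shows "frame_bounds p (F \<times> G) (\<lambda>(f, g). n f * m g) (I \<times> J) (\<lambda>(f, g) (i, j). a f i * b g j)"
proof -
  from F obtain A B where AB: "0 < A" "0 < B" and sa: "\<And>f. f \<in> F \<Longrightarrow> a f summable_on I"
    and lo: "\<And>f. f \<in> F \<Longrightarrow> A * n f \<le> (\<Sum>\<^sub>\<infinity>i\<in>I. a f i) powr (1 / p)"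
    and up: "\<And>f. f \<in> F \<Longrightarrow> (\<Sum>\<^sub>\<infinity>i\<in>I. a f i) powr (1 / p) \<le> B * n f"
    by (rule frame_boundsE) blast
  from G obtain A' B' where AB': "0 < A'" "0 < B'" and sb: "\<And>g. g \<in> G \<Longrightarrow> b g summable_on J"
    and lo': "\<And>g. g \<in> G \<Longrightarrow> A' * m g \<le> (\<Sum>\<^sub>\<infinity>j\<in>J. b g j) powr (1 / p)"
    and up': "\<And>g. g \<in> G \<Longrightarrow> (\<Sum>\<^sub>\<infinity>j\<in>J. b g j) powr (1 / p) \<le> B' * m g"
    by (rule frame_boundsE) blast
  have "(\<lambda>(i, j). a f i * b g j) summable_on I \<times> J \<and>
      (A * A') * (n f * m g) \<le> (\<Sum>\<^sub>\<infinity>(i, j)\<in>I \<times> J. a f i * b g j) powr (1 / p) \<and>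
      (\<Sum>\<^sub>\<infinity>(i, j)\<in>I \<times> J. a f i * b g j) powr (1 / p) \<le> (B * B') * (n f * m g)"
    if fg: "f \<in> F" "g \<in> G" for f g
  proof -
    let ?S = "\<Sum>\<^sub>\<infinity>i\<in>I. a f i" and ?T = "\<Sum>\<^sub>\<infinity>j\<in>J. b g j"
    have ST: "((\<lambda>(i, j). a f i * b g j) has_sum ?S * ?T) (I \<times> J)"
      using fg by (intro has_sum_times_nonneg has_sum_infsum sa sb a b)
    have "0 \<le> ?S" "0 \<le> ?T"
      using fg by (auto intro!: infsum_nonneg a b)
    then have powr: "(?S * ?T) powr (1 / p) = ?S powr (1 / p) * ?T powr (1 / p)"
      by (simp add: powr_mult)
    have "(A * n f) * (A' * m g) \<le> ?S powr (1 / p) * ?T powr (1 / p)"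
      using fg AB' by (intro mult_mono lo lo') (simp_all add: m)
    moreover have "?S powr (1 / p) * ?T powr (1 / p) \<le> (B * n f) * (B' * m g)"
      using fg AB by (intro mult_mono up up') (simp_all add: n)
    ultimately show ?thesis
      using ST by (simp add: has_sum_imp_summable infsumI[OF ST] powr mult_ac)
  qed
  moreover have "0 < A * A'" "0 < B * B'"
    using AB AB' by simp_all
  ultimately show ?thesis
    unfolding frame_bounds_def by (intro exI[of _ "A * A'"] exI[of _ "B * B'"]) simp
qed

text \<open>
  Positivity of the sum at \<open>(f\<^sub>0, g\<^sub>0)\<close> yields indices \<open>i\<^sub>0\<close>, \<open>j\<^sub>0\<close> with both factors nonzero. Column
  \<open>j\<^sub>0\<close> shows that every \<open>a f\<close> is summable and row \<open>i\<^sub>0\<close> that \<open>b g\<^sub>0\<close> is. So the double sums over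
  \<open>(f, g\<^sub>0)\<close> factor, with a positive second factor, by which one may divide.
\<close>

lemma frame_bounds_factor:
  assumes FG: "frame_bounds p (F \<times> G) (\<lambda>(f, g). n f * m g) (I \<times> J)
      (\<lambda>(f, g) (i, j). a f i * b g j)"
    and f0: "f0 \<in> F" "0 < n f0" and g0: "g0 \<in> G" "0 < m g0"
    and a: "\<And>f i. f \<in> F \<Longrightarrow> i \<in> I \<Longrightarrow> 0 \<le> a f i" and b: "\<And>g j. g \<in> G \<Longrightarrow> j \<in> J \<Longrightarrow> 0 \<le> b g j"
  shows "frame_bounds p F n I a"
proof -
  let ?ab = "\<lambda>f (i, j). a f i * b g0 j"
  from FG obtain A B where AB: "0 < A" "0 < B"
    and sum: "\<And>f. f \<in> F \<Longrightarrow> ?ab f summable_on I \<times> J"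
    and lo: "\<And>f. f \<in> F \<Longrightarrow> A * (n f * m g0) \<le> infsum (?ab f) (I \<times> J) powr (1 / p)"
    and up: "\<And>f. f \<in> F \<Longrightarrow> infsum (?ab f) (I \<times> J) powr (1 / p) \<le> B * (n f * m g0)"
    using g0(1) by (elim frame_boundsE) fastforce
  have "0 < A * (n f0 * m g0)"
    using AB f0 g0 by simp
  with lo[OF f0(1)] have pos: "infsum (?ab f0) (I \<times> J) \<noteq> 0"
    by auto
  then obtain i0 j0 where i0: "i0 \<in> I" "a f0 i0 \<noteq> 0" and j0: "j0 \<in> J" "b g0 j0 \<noteq> 0"
    using infsum_0[of "I \<times> J" "?ab f0"] by fastforce
  have sa: "a f summable_on I" if "f \<in> F" for f
    using sum[OF that] j0 by (rule summable_on_left_factor)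
  have sb: "b g0 summable_on J"
    using sum[OF f0(1)] i0 by (rule summable_on_right_factor)
  define T where "T = (\<Sum>\<^sub>\<infinity>j\<in>J. b g0 j)"
  have prod: "infsum (?ab f) (I \<times> J) = (\<Sum>\<^sub>\<infinity>i\<in>I. a f i) * T" if "f \<in> F" for f
    unfolding T_def using that g0(1)
    by (intro infsumI has_sum_times_nonneg has_sum_infsum sa sb a b)
  have "0 \<le> T"
    unfolding T_def using g0(1) by (intro infsum_nonneg b)
  moreover have "T \<noteq> 0"
    using pos prod[OF f0(1)] by auto
  ultimately have T: "0 < T"
    by simp
  define c where "c = T powr (1 / p)"
  have c: "0 < c"
    using T by (simp add: c_def)
  have "(A * m g0 / c) * n f \<le> (\<Sum>\<^sub>\<infinity>i\<in>I. a f i) powr (1 / p) \<and>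
      (\<Sum>\<^sub>\<infinity>i\<in>I. a f i) powr (1 / p) \<le> (B * m g0 / c) * n f" if f: "f \<in> F" for f
  proof -
    have "0 \<le> (\<Sum>\<^sub>\<infinity>i\<in>I. a f i)"
      using f by (intro infsum_nonneg a)
    then have "infsum (?ab f) (I \<times> J) powr (1 / p) = (\<Sum>\<^sub>\<infinity>i\<in>I. a f i) powr (1 / p) * c"
      using T by (simp add: prod[OF f] powr_mult c_def)
    then show ?thesis
      using lo[OF f] up[OF f] c by (simp add: field_simps)
  qed
  moreover have "0 < A * m g0 / c" "0 < B * m g0 / c"
    using AB g0 c by simp_all
  ultimately show ?thesis
    unfolding frame_bounds_def using sa by blast
qed

lemma frame_bounds_swap:
  assumes "frame_bounds p (F \<times> G) (\<lambda>(f, g). n f * m g) (I \<times> J) (\<lambda>(f, g) (i, j). a f i * b g j)"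
  shows "frame_bounds p (G \<times> F) (\<lambda>(g, f). m g * n f) (J \<times> I) (\<lambda>(g, f) (j, i). b g j * a f i)"
proof -
  have summable: "(\<lambda>(j, i). b g j * a f i) summable_on J \<times> I \<longleftrightarrow>
      (\<lambda>(i, j). a f i * b g j) summable_on I \<times> J" for f g
    by (subst summable_on_swap) (simp add: mult.commute)
  have infsum: "(\<Sum>\<^sub>\<infinity>(j, i)\<in>J \<times> I. b g j * a f i) = (\<Sum>\<^sub>\<infinity>(i, j)\<in>I \<times> J. a f i * b g j)" for f g
    using infsum_reindex_bij_witness[of "J \<times> I" prod.swap prod.swap "I \<times> J"
        "\<lambda>(i, j). a f i * b g j" "\<lambda>(j, i). b g j * a f i"]
    by (auto simp: mult.commute)
  show ?thesis
    using assms unfolding frame_bounds_def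
    by (auto simp: summable infsum mult.commute[of "m _"])
qed

section \<open>Frame bounds of fusion frames\<close>

definition frame_term ::
  "real \<Rightarrow> (nat \<Rightarrow> ('k, 'c) normed_module) \<Rightarrow> (nat \<Rightarrow> 'a \<Rightarrow> 'a) \<Rightarrow> (nat \<Rightarrow> 'a \<Rightarrow> 'c) \<Rightarrow>
   (nat \<Rightarrow> real) \<Rightarrow> 'a \<Rightarrow> nat \<Rightarrow> real" where
  "frame_term p Xs P \<Lambda> v f i = v i powr p * vnorm (Xs i) (\<Lambda> i (P i f)) powr p"

text \<open>
  Enlarging \<open>B\<close> to \<open>max A B\<close> reconciles the requirement \<open>A \<le> B\<close> with the two bounds merely being
  positive.
\<close>

lemma g_p_fusion_frame_iff:
  assumes "normed_space X"
  shows "g_p_fusion_frame p X I Xs P \<Lambda> v \<longleftrightarrow>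
    frame_bounds p (carrier X) (vnorm X) I (frame_term p Xs P \<Lambda> v)"
proof
  assume "g_p_fusion_frame p X I Xs P \<Lambda> v"
  then show "frame_bounds p (carrier X) (vnorm X) I (frame_term p Xs P \<Lambda> v)"
    unfolding g_p_fusion_frame_def frame_bounds_def frame_term_def by (meson order.strict_trans2)
next
  assume "frame_bounds p (carrier X) (vnorm X) I (frame_term p Xs P \<Lambda> v)"
  then obtain A B where AB: "0 < A" "0 < B"
    and s: "\<And>f. f \<in> carrier X \<Longrightarrow> frame_term p Xs P \<Lambda> v f summable_on I"
    and lo: "\<And>f. f \<in> carrier X \<Longrightarrow>
      A * vnorm X f \<le> (\<Sum>\<^sub>\<infinity>i\<in>I. frame_term p Xs P \<Lambda> v f i) powr (1 / p)"
    and up: "\<And>f. f \<in> carrier X \<Longrightarrow>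
      (\<Sum>\<^sub>\<infinity>i\<in>I. frame_term p Xs P \<Lambda> v f i) powr (1 / p) \<le> B * vnorm X f"
    by (rule frame_boundsE) blast
  have "B * vnorm X f \<le> max A B * vnorm X f" if "f \<in> carrier X" for f
    using normed_space.vnorm_nonneg[OF assms that] by (intro mult_right_mono) simp_all
  with up have "(\<Sum>\<^sub>\<infinity>i\<in>I. frame_term p Xs P \<Lambda> v f i) powr (1 / p) \<le> max A B * vnorm X f"
    if "f \<in> carrier X" for f
    using that order.trans by blast
  with s lo AB(1) show "g_p_fusion_frame p X I Xs P \<Lambda> v"
    unfolding g_p_fusion_frame_def frame_term_def
    by (intro exI[of _ A] exI[of _ "max A B"]) simp
qed

lemma tensor_map_tensor_map_tens:
  assumes "projection_onto X V P" "bounded_linear_op X X' L"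
    and "projection_onto Y W Q" "bounded_linear_op Y Y' M"
    and "cross_norm X' Y' N" and "f \<in> carrier X" "g \<in> carrier Y"
  shows "N (tensor_map X Y X' Y' L M (tensor_map X Y X Y P Q (tens X Y f g))) =
    vnorm X' (L (P f)) * vnorm Y' (M (Q g))"
proof -
  have lin: "linear_op X X P" "linear_op Y Y Q" "linear_op X X' L" "linear_op Y Y' M"
    using assms(1-4) by (simp_all add: projection_onto_def bounded_linear_op_def)
  then have PQ: "P f \<in> carrier X" "Q g \<in> carrier Y"
    using assms(6,7) by (auto simp: linear_op_def)
  with lin have "L (P f) \<in> carrier X'" "M (Q g) \<in> carrier Y'"
    by (auto simp: linear_op_def)
  with assms(5) show ?thesis
    by (simp add: lin PQ assms(6,7) tensor_map_tens cross_norm_def)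
qed

lemma tensor_g_p_fusion_frame_iff:
  assumes X: "fusion_family X I Xs V P \<Lambda> v" and Y: "fusion_family Y J Ys W Q \<Gamma> w"
    and N: "cross_norm X Y N"
    and Ns: "\<And>i j. i \<in> I \<Longrightarrow> j \<in> J \<Longrightarrow> cross_norm (Xs i) (Ys j) (Ns i j)"
  shows "tensor_g_p_fusion_frame p X Y N I J Xs Ys Ns P Q \<Lambda> \<Gamma> v w \<longleftrightarrow>
    frame_bounds p (carrier X \<times> carrier Y) (\<lambda>(f, g). vnorm X f * vnorm Y g) (I \<times> J)
      (\<lambda>(f, g) (i, j). frame_term p Xs P \<Lambda> v f i * frame_term p Ys Q \<Gamma> w g j)"
proof -
  let ?t = "\<lambda>f g (i, j). v i powr p * w j powr p *
    Ns i j (tensor_map X Y (Xs i) (Ys j) (\<Lambda> i) (\<Gamma> j)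
      (tensor_map X Y X Y (P i) (Q j) (tens X Y f g))) powr p"
  let ?u = "\<lambda>f g (i, j). frame_term p Xs P \<Lambda> v f i * frame_term p Ys Q \<Gamma> w g j"
  have eq: "?t f g ij = ?u f g ij"
    if fg: "f \<in> carrier X" "g \<in> carrier Y" and ij: "ij \<in> I \<times> J" for f g ij
  proof -
    obtain i j where ij: "ij = (i, j)" "i \<in> I" "j \<in> J"
      using ij by auto
    have ops: "projection_onto X (V i) (P i)" "bounded_linear_op X (Xs i) (\<Lambda> i)"
      "projection_onto Y (W j) (Q j)" "bounded_linear_op Y (Ys j) (\<Gamma> j)"
      and sp: "normed_space (Xs i)" "normed_space (Ys j)"
      using X Y ij by (simp_all add: fusion_family_def banach_space_def)
    have "\<Lambda> i (P i f) \<in> carrier (Xs i)" "\<Gamma> j (Q j g) \<in> carrier (Ys j)"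
      using ops fg by (fastforce simp: projection_onto_def bounded_linear_op_def linear_op_def)+
    then have "0 \<le> vnorm (Xs i) (\<Lambda> i (P i f))" "0 \<le> vnorm (Ys j) (\<Gamma> j (Q j g))"
      using sp by (simp_all add: normed_space.vnorm_nonneg)
    then show ?thesis
      using tensor_map_tensor_map_tens[OF ops Ns[OF ij(2,3)] fg]
      by (simp add: ij(1) frame_term_def powr_mult mult_ac)
  qed
  have "?t f g summable_on I \<times> J \<longleftrightarrow> ?u f g summable_on I \<times> J"
    if "f \<in> carrier X" "g \<in> carrier Y" for f g
    by (rule summable_on_cong[OF eq[OF that]])
  moreover have "infsum (?t f g) (I \<times> J) = infsum (?u f g) (I \<times> J)"
    if "f \<in> carrier X" "g \<in> carrier Y" for f g
    by (rule infsum_cong[OF eq[OF that]])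
  moreover have "N (tens X Y f g) = vnorm X f * vnorm Y g"
    if "f \<in> carrier X" "g \<in> carrier Y" for f g
    using N that by (simp add: cross_norm_def)
  ultimately show ?thesis
    unfolding tensor_g_p_fusion_frame_def frame_bounds_def Let_def by simp
qed

lemma (in normed_space) exists_vnorm_pos:
  assumes "carrier X \<noteq> {\<zero>}"
  obtains x where "x \<in> carrier X" "0 < vnorm X x"
proof -
  from assms obtain x where "x \<in> carrier X" "x \<noteq> \<zero>"
    using M.zero_closed by blast
  with that[of x] vnorm_nonneg[of x] vnorm_eq_0_iff[of x] show ?thesis
    by simp
qed

theorem theorem4p6:
  fixes X :: "('k::real_normed_field, 'a) normed_module"
    and Y :: "('k, 'b) normed_module"
    and Xs :: "nat \<Rightarrow> ('k, 'c) normed_module"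
    and Ys :: "nat \<Rightarrow> ('k, 'd) normed_module"
    and I J :: "nat set"
    and p :: real
    and V :: "nat \<Rightarrow> 'a set" and P :: "nat \<Rightarrow> 'a \<Rightarrow> 'a"
    and \<Lambda> :: "nat \<Rightarrow> 'a \<Rightarrow> 'c" and v :: "nat \<Rightarrow> real"
    and W :: "nat \<Rightarrow> 'b set" and Q :: "nat \<Rightarrow> 'b \<Rightarrow> 'b"
    and \<Gamma> :: "nat \<Rightarrow> 'b \<Rightarrow> 'd" and w :: "nat \<Rightarrow> real"
    and N :: "('a \<times> 'b \<Rightarrow>\<^sub>0 'k) set \<Rightarrow> real"
    and Ns :: "nat \<Rightarrow> nat \<Rightarrow> ('c \<times> 'd \<Rightarrow>\<^sub>0 'k) set \<Rightarrow> real"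
  assumes "1 < p"
    and "banach_space X" and "separable_space (vtopology X)" and "carrier X \<noteq> {\<zero>\<^bsub>X\<^esub>}"
    and "banach_space Y" and "separable_space (vtopology Y)" and "carrier Y \<noteq> {\<zero>\<^bsub>Y\<^esub>}"
    and "fusion_family X I Xs V P \<Lambda> v"
    and "fusion_family Y J Ys W Q \<Gamma> w"
    and "cross_norm X Y N"
    and "\<And>i j. i \<in> I \<Longrightarrow> j \<in> J \<Longrightarrow> cross_norm (Xs i) (Ys j) (Ns i j)"
  shows "tensor_g_p_fusion_frame p X Y N I J Xs Ys Ns P Q \<Lambda> \<Gamma> v w \<longleftrightarrow>
         g_p_fusion_frame p X I Xs P \<Lambda> v \<and> g_p_fusion_frame p Y J Ys Q \<Gamma> w"
proof -
  have X: "normed_space X" and Y: "normed_space Y"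
    using assms(2,5) by (simp_all add: banach_space_def)
  let ?a = "frame_term p Xs P \<Lambda> v" and ?b = "frame_term p Ys Q \<Gamma> w"
  have a: "0 \<le> ?a f i" and b: "0 \<le> ?b g j" for f g i j
    by (simp_all add: frame_term_def)
  obtain f0 where f0: "f0 \<in> carrier X" "0 < vnorm X f0"
    using normed_space.exists_vnorm_pos[OF X assms(4)] .
  obtain g0 where g0: "g0 \<in> carrier Y" "0 < vnorm Y g0"
    using normed_space.exists_vnorm_pos[OF Y assms(7)] .
  have "frame_bounds p (carrier X \<times> carrier Y) (\<lambda>(f, g). vnorm X f * vnorm Y g) (I \<times> J)
      (\<lambda>(f, g) (i, j). ?a f i * ?b g j) \<longleftrightarrow>
    frame_bounds p (carrier X) (vnorm X) I ?a \<and> frame_bounds p (carrier Y) (vnorm Y) J ?b"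
    (is "?XY \<longleftrightarrow> _")
  proof (intro iffI conjI)
    assume XY: ?XY
    show "frame_bounds p (carrier X) (vnorm X) I ?a"
      using XY f0 g0 a b by (rule frame_bounds_factor)
    show "frame_bounds p (carrier Y) (vnorm Y) J ?b"
      using frame_bounds_swap[OF XY] g0 f0 b a by (rule frame_bounds_factor)
  next
    assume "frame_bounds p (carrier X) (vnorm X) I ?a \<and> frame_bounds p (carrier Y) (vnorm Y) J ?b"
    then show ?XY
      using normed_space.vnorm_nonneg[OF X] normed_space.vnorm_nonneg[OF Y] a b
      by (intro frame_bounds_product) auto
  qed
  then show ?thesis
    by (simp add: tensor_g_p_fusion_frame_iff[OF assms(8-11)] g_p_fusion_frame_iff[OF X]
        g_p_fusion_frame_iff[OF Y])
qed

end
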